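(* Let $x$ be a positive integer and $\{x_i\}_{i=1}^\infty$ a strictly increasing infinite sequence of positive integers such that (i) $\gcd(x_i,x_j)=x$ for every $i\ne j$, and (ii) $\sum_{i=1}^\infty \frac1{x_i}=\infty$. Let $\lambda_n^{(1)}$ be the smallest eigenvalue of the $n\times n$ matrix $\big(f(\gcd(x_i,x_j))\big)_{1\le i,j\le n}$. If $f\in\mathcal{C}$, $f$ is increasing on $\{x_i\}_{i=1}^\infty$, and $f(x_i)\le Cx_i$ for all $i\ge1$ for some constant $C>0$, then $\lim_{n\to\infty}\lambda_n^{(1)}=f(x_1)-f(x)$.
   Context: An arithmetical function is a complex-valued function on the positive integers; $\mu$ is the Möbius function and $(f*\mu)(m)=\sum_{e\mid m}f(e)\mu(m/e)$. For the given sequence $\{x_i\}$, $\mathcal{C}$ is the class of arithmetical functions $f$ such that $(f*\mu)(d')\ge0$ (in particular is real) whenever $d'\mid x_i$ for some $i\ge1$. $f$ is increasing on $\{x_i\}$ means $f(x_i)\le f(x_j)$ whenever $1\le i<j$. *)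

theory Defs
  imports
    "HOL-Analysis.Analysis"
    "HOL-Library.Complex_Order"
    "HOL-Computational_Algebra.Squarefree"
    "Jordan_Normal_Form.Char_Poly"
begin

text \<open>
  Arithmetical functions are represented by functions \<open>f :: nat \<Rightarrow> complex\<close>, of which only the
  values at positive arguments are used. Sequences \<open>(x\<^sub>i)\<close> are indexed from 1; the entry at
  index 0 is never used.

  The order on \<^typ>\<open>complex\<close> is the one of \<open>HOL-Library.Complex_Order\<close>: \<open>z \<le> w\<close> means
  \<open>Re z \<le> Re w\<close> and \<open>Im z = Im w\<close>. In particular \<open>0 \<le> z\<close> says that \<open>z\<close> is real and nonnegative.
\<close>

definition moebius :: "nat \<Rightarrow> complex" where
  "moebius n = (if squarefree n then (- 1) ^ card (prime_factors n) else 0)"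

definition dirichlet_conv :: "(nat \<Rightarrow> complex) \<Rightarrow> (nat \<Rightarrow> complex) \<Rightarrow> nat \<Rightarrow> complex" where
  "dirichlet_conv f g m = (\<Sum>e | e dvd m. f e * g (m div e))"

definition class_C :: "(nat \<Rightarrow> nat) \<Rightarrow> (nat \<Rightarrow> complex) set" where
  "class_C xs = {f. \<forall>d. (\<exists>i\<ge>1. d dvd xs i) \<longrightarrow> 0 \<le> dirichlet_conv f moebius d}"

text \<open>Matrix indices start at 0, hence the shift.\<close>

definition gcd_matrix :: "(nat \<Rightarrow> complex) \<Rightarrow> (nat \<Rightarrow> nat) \<Rightarrow> nat \<Rightarrow> complex mat" where
  "gcd_matrix f xs n = mat n n (\<lambda>(i, j). f (gcd (xs (Suc i)) (xs (Suc j))))"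

text \<open>
  The least element of the spectrum for the order on \<^typ>\<open>complex\<close> above. It exists whenever the
  matrix is nonempty and all its eigenvalues are real, as for real symmetric matrices; otherwise
  the value may be unspecified.
\<close>

definition smallest_eigenvalue :: "complex mat \<Rightarrow> complex" where
  "smallest_eigenvalue A = (LEAST l. eigenvalue A l)"

end

theory Submission
  imports Defs
begin

text \<open>
  With \<open>a = f x\<close> and \<open>d\<^sub>i = f (x\<^sub>i) - f x\<close> the matrix is \<open>diag (d\<^sub>1, \<dots>, d\<^sub>n) + a J\<close>, where \<open>J\<close> is the
  all-ones matrix; Moebius inversion and \<open>f \<in> \<C>\<close> give \<open>a \<ge> 0\<close>, so every eigenvalue is at least
  \<open>d\<^sub>1\<close>. If \<open>a = 0\<close> or \<open>d\<^sub>1 = d\<^sub>2\<close>, then \<open>d\<^sub>1\<close> itself is an eigenvalue. If \<open>0 < a\<close> and \<open>d\<^sub>1 < d\<^sub>2\<close>, a root \<open>l\<close> of the secular equation \<open>1 + a \<Sum>\<^sub>i 1 / (d\<^sub>i - l) = 0\<close> is an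
  eigenvalue with eigenvector \<open>(1 / (d\<^sub>i - l))\<^sub>i\<close>. Since \<open>d\<^sub>i - d\<^sub>1 \<le> C x\<^sub>i\<close>, the divergence of
  \<open>\<Sum> 1 / x\<^sub>i\<close> makes the secular function positive at \<open>d\<^sub>1 + \<epsilon>\<close> for large \<open>n\<close>, while it tends to
  \<open>-\<infinity>\<close> at \<open>d\<^sub>1\<close> from the right; hence there is a root in \<open>(d\<^sub>1, d\<^sub>1 + \<epsilon>)\<close>.
\<close>

section \<open>Moebius inversion\<close>

lemma prime_factors_prod_primes:
  fixes P :: "nat set"
  assumes "finite P" "\<And>p. p \<in> P \<Longrightarrow> prime p"
  shows "prime_factors (\<Prod>P) = P"
  using assms
proof (induction P rule: finite_induct)
  case (insert p P)
  have "\<Prod>P \<noteq> 0"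
    using insert by (metis not_prime_0 insertCI prod_zero_iff)
  moreover have "prime p"
    using insert by simp
  moreover from this have "p \<noteq> 0"
    by auto
  ultimately show ?case
    using insert by (simp add: prime_factors_product prime_prime_factors)
qed simp

lemma prod_prime_factors_squarefree:
  fixes k :: nat
  assumes "squarefree k"
  shows "\<Prod>(prime_factors k) = k"
proof -
  have "k \<noteq> 0"
    using assms by (metis not_squarefree_0)
  with assms have "(\<Prod>p\<in>prime_factors k. p ^ multiplicity p k) = \<Prod>(prime_factors k)"
    by (intro prod.cong) (auto simp: squarefree_factorial_semiring')
  with \<open>k \<noteq> 0\<close> prod_prime_factors[of k] show ?thesis
    by simp
qed

lemma prod_dvd_of_subset_prime_factors:
  fixes n :: nat
  assumes "n \<noteq> 0" "P \<subseteq> prime_factors n"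
  shows "\<Prod>P dvd n"
proof -
  have "\<Prod>P dvd \<Prod>(prime_factors n)"
    using assms by (intro prod_dvd_prod_subset) auto
  also have "\<dots> dvd (\<Prod>p\<in>prime_factors n. p ^ multiplicity p n)"
    by (intro prod_dvd_prod) (auto simp: prime_factors_multiplicity intro: dvd_power)
  also have "\<dots> = n"
    using assms prod_prime_factors[of n] by simp
  finally show ?thesis .
qed

text \<open>Only squarefree divisors contribute, and \<open>prime_factors\<close> matches them with
  the subsets of the prime factors of \<open>n\<close>. The signed sum over subsets factors as a
  product of terms \<open>- 1 + 1\<close>, which is empty exactly for \<open>n = 1\<close>.\<close>

lemma sum_moebius_divisors:
  assumes "n > 0"
  shows "(\<Sum>k | k dvd n. moebius k) = (if n = 1 then 1 else 0)"
proof -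
  have "(\<Sum>k | k dvd n. moebius k)
      = (\<Sum>k | k dvd n \<and> squarefree k. (- 1) ^ card (prime_factors k))"
    using assms by (intro sum.mono_neutral_cong_right) (auto simp: moebius_def)
  also have "\<dots> = (\<Sum>P\<in>Pow (prime_factors n). (- 1) ^ card P)"
  proof (rule sum.reindex_bij_witness[where i = "\<lambda>P. \<Prod>P" and j = prime_factors])
    fix k assume k: "k \<in> {k. k dvd n \<and> squarefree k}"
    show "\<Prod>(prime_factors k) = k"
      using k by (simp add: prod_prime_factors_squarefree)
    show "prime_factors k \<in> Pow (prime_factors n)"
      using k assms dvd_prime_factors[of n k] by auto
  next
    fix P assume P: "P \<in> Pow (prime_factors n)"
    have fin: "finite P"
      using P by (auto intro: finite_subset)
    have prm: "\<And>p. p \<in> P \<Longrightarrow> prime p"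
      using P by auto
    show "prime_factors (\<Prod>P) = P"
      using fin prm by (rule prime_factors_prod_primes)
    have "squarefree (\<Prod>P)"
      using prm by (intro squarefree_prod_coprime) (auto intro: primes_coprime squarefree_prime)
    moreover have "\<Prod>P dvd n"
      using assms P by (intro prod_dvd_of_subset_prime_factors) auto
    ultimately show "\<Prod>P \<in> {k. k dvd n \<and> squarefree k}"
      by simp
  qed simp
  also have "\<dots> = (\<Prod>p\<in>prime_factors n. - 1 + 1)"
    by (subst prod_add) simp_all
  also have "\<dots> = (if n = 1 then 1 else 0)"
    using assms by (auto simp: prime_factorization_empty_iff card_gt_0_iff)
  finally show ?thesis .
qed

text \<open>Exchange the order of summation: with \<open>d = e * k\<close>, the chain
  \<open>e dvd d dvd m\<close> becomes \<open>k dvd m div e\<close>. The inner sum of Moebius values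
  then vanishes unless \<open>e = m\<close>.\<close>

lemma sum_dirichlet_conv_moebius:
  assumes "m > 0"
  shows "(\<Sum>d | d dvd m. dirichlet_conv f moebius d) = f m"
proof -
  have fin: "finite {d. d dvd m}"
    using assms by simp
  have "(\<Sum>d | d dvd m. dirichlet_conv f moebius d)
      = (\<Sum>(d, e)\<in>(SIGMA d:{d. d dvd m}. {e. e dvd d}). f e * moebius (d div e))"
    unfolding dirichlet_conv_def using assms
    by (intro sum.Sigma) (auto intro: finite_divisors_nat dest: dvd_pos_nat)
  also have "\<dots> = (\<Sum>(e, k)\<in>(SIGMA e:{e. e dvd m}. {k. k dvd m div e}). f e * moebius k)"
    using assms
    by (intro sum.reindex_bij_witness[where i = "\<lambda>(e, k). (e * k, e)" and j = "\<lambda>(d, e). (e, d div e)"])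
       (auto elim!: dvdE intro: dvd_trans)
  also have "\<dots> = (\<Sum>e | e dvd m. \<Sum>k | k dvd m div e. f e * moebius k)"
    using assms
    by (intro sum.Sigma[symmetric]) (auto intro!: finite_divisors_nat elim!: dvdE)
  also have "\<dots> = (\<Sum>e | e dvd m. if e = m then f e else 0)"
  proof (rule sum.cong)
    fix e assume "e \<in> {e. e dvd m}"
    then obtain q where q: "m = e * q" by (auto elim: dvdE)
    have pos: "e > 0" "q > 0" using assms q by auto
    have "(\<Sum>k | k dvd m div e. f e * moebius k) = f e * (\<Sum>k | k dvd q. moebius k)"
      using q pos by (simp add: sum_distrib_left)
    also have "\<dots> = (if e = m then f e else 0)"
      using pos q by (simp add: sum_moebius_divisors)
    finally show "(\<Sum>k | k dvd m div e. f e * moebius k) = (if e = m then f e else 0)" .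
  qed simp
  also have "\<dots> = f m"
    using fin by (simp add: sum.delta)
  finally show ?thesis .
qed

text \<open>By inversion, \<open>f m\<close> is a sum of convolution values at divisors of
  \<open>xs i\<close>, each nonnegative by membership in the class.\<close>

lemma class_C_nonneg:
  assumes "f \<in> class_C xs" "i \<ge> 1" "m dvd xs i" "m > 0"
  shows "0 \<le> f m"
proof -
  have "0 \<le> (\<Sum>d | d dvd m. dirichlet_conv f moebius d)"
    using assms by (intro sum_nonneg) (auto simp: class_C_def intro: dvd_trans)
  with assms show ?thesis
    by (simp add: sum_dirichlet_conv_moebius)
qed

section \<open>Eigenvalues of a diagonal matrix plus a constant matrix\<close>

definition diag_plus_const :: "(nat \<Rightarrow> real) \<Rightarrow> real \<Rightarrow> nat \<Rightarrow> complex mat" where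
  "diag_plus_const d a n = mat n n (\<lambda>(i, j). of_real ((if i = j then d i else 0) + a))"

lemma diag_plus_const_carrier [simp]: "diag_plus_const d a n \<in> carrier_mat n n"
  by (simp add: diag_plus_const_def)

lemma diag_plus_const_mult_index:
  assumes "v \<in> carrier_vec n" "i < n"
  shows "(diag_plus_const d a n *\<^sub>v v) $ i = of_real (d i) * v $ i + of_real a * (\<Sum>j<n. v $ j)"
proof -
  have "(diag_plus_const d a n *\<^sub>v v) $ i
      = (\<Sum>j<n. of_real ((if i = j then d i else 0) + a) * v $ j)"
    using assms by (simp add: diag_plus_const_def scalar_prod_def lessThan_atLeast0)
  also have "\<dots> = (\<Sum>j<n. (if j = i then of_real (d i) * v $ j else 0) + of_real a * v $ j)"
    by (intro sum.cong) (auto simp: algebra_simps)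
  also have "\<dots> = of_real (d i) * v $ i + of_real a * (\<Sum>j<n. v $ j)"
    using assms by (simp add: sum.distrib sum_distrib_left)
  finally show ?thesis .
qed

text \<open>Replaces vectors of length \<open>n\<close> by plain functions, so that eigenvectors can
  be given by formulas and sums handled directly.\<close>

lemma eigenvalue_diag_plus_const_iff:
  "eigenvalue (diag_plus_const d a n) l \<longleftrightarrow>
    (\<exists>v. (\<exists>i<n. v i \<noteq> 0) \<and> (\<forall>i<n. of_real (d i) * v i + of_real a * (\<Sum>j<n. v j) = l * v i))"
proof
  assume "eigenvalue (diag_plus_const d a n) l"
  then obtain v where v: "v \<in> carrier_vec n" "v \<noteq> 0\<^sub>v n" "diag_plus_const d a n *\<^sub>v v = l \<cdot>\<^sub>v v"
    by (auto simp: eigenvalue_def eigenvector_def diag_plus_const_def)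
  have "\<exists>i<n. v $ i \<noteq> 0"
    using v(1,2) by (metis carrier_vecD eq_vecI index_zero_vec)
  moreover have "of_real (d i) * v $ i + of_real a * (\<Sum>j<n. v $ j) = l * v $ i" if "i < n" for i
    using diag_plus_const_mult_index[OF v(1) that, of d a] v that by simp
  ultimately show "\<exists>v. (\<exists>i<n. v i \<noteq> 0) \<and>
      (\<forall>i<n. of_real (d i) * v i + of_real a * (\<Sum>j<n. v j) = l * v i)"
    by (intro exI[of _ "\<lambda>i. v $ i"]) auto
next
  assume "\<exists>v. (\<exists>i<n. v i \<noteq> 0) \<and>
      (\<forall>i<n. of_real (d i) * v i + of_real a * (\<Sum>j<n. v j) = l * v i)"
  then obtain v i where v: "\<forall>i<n. of_real (d i) * v i + of_real a * (\<Sum>j<n. v j) = l * v i"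
      and i: "i < n" "v i \<noteq> 0"
    by blast
  have "vec n v \<noteq> 0\<^sub>v n"
    using i by (metis index_vec index_zero_vec(1))
  moreover have "diag_plus_const d a n *\<^sub>v vec n v = l \<cdot>\<^sub>v vec n v"
  proof (rule eq_vecI)
    fix k assume "k < dim_vec (l \<cdot>\<^sub>v vec n v)"
    then have k: "k < n" by simp
    show "(diag_plus_const d a n *\<^sub>v vec n v) $ k = (l \<cdot>\<^sub>v vec n v) $ k"
      using v k by (subst diag_plus_const_mult_index) auto
  qed (simp add: diag_plus_const_def)
  ultimately show "eigenvalue (diag_plus_const d a n) l"
    by (auto simp: eigenvalue_def eigenvector_def diag_plus_const_def intro!: exI[of _ "vec n v"])
qed

text \<open>Rayleigh quotient: pairing the eigenvector equation with \<open>cnj v\<close> gives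
  \<open>l = R / N\<close> with \<open>R\<close> and \<open>N\<close> real. This yields both the
  bound and the realness of \<open>l\<close>, which the order on the complex numbers
  demands.\<close>

lemma eigenvalue_diag_plus_const_ge:
  assumes "eigenvalue (diag_plus_const d a n) l" "a \<ge> 0" "\<And>i. i < n \<Longrightarrow> c \<le> d i"
  shows "complex_of_real c \<le> l"
proof -
  obtain v i where v: "\<forall>i<n. of_real (d i) * v i + of_real a * (\<Sum>j<n. v j) = l * v i"
      and i: "i < n" "v i \<noteq> 0"
    using assms(1) unfolding eigenvalue_diag_plus_const_iff by blast
  define N where "N = (\<Sum>j<n. (cmod (v j))\<^sup>2)"
  define R where "R = (\<Sum>j<n. d j * (cmod (v j))\<^sup>2) + a * (cmod (\<Sum>j<n. v j))\<^sup>2"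
  have "N > 0"
    unfolding N_def using i by (intro sum_pos2[of _ i]) auto
  have "l * of_real N = (\<Sum>j<n. l * v j * cnj (v j))"
    unfolding N_def by (simp add: complex_norm_square sum_distrib_left mult.assoc del: of_real_power)
  also have "\<dots> = (\<Sum>j<n. (of_real (d j) * v j + of_real a * (\<Sum>j<n. v j)) * cnj (v j))"
    using v by (intro sum.cong) auto
  also have "\<dots> = (\<Sum>j<n. of_real (d j) * (v j * cnj (v j)))
      + of_real a * ((\<Sum>j<n. v j) * cnj (\<Sum>j<n. v j))"
    by (simp add: distrib_right sum.distrib mult.assoc flip: sum_distrib_left)
  also have "\<dots> = of_real R"
    unfolding R_def by (simp add: complex_norm_square del: of_real_power)
  finally have "l = of_real (R / N)"
    using \<open>N > 0\<close> by (simp add: field_simps)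
  moreover have "c * N \<le> R"
  proof -
    have "c * N \<le> (\<Sum>j<n. d j * (cmod (v j))\<^sup>2)"
      unfolding N_def sum_distrib_left using assms(3) by (intro sum_mono mult_right_mono) auto
    with \<open>a \<ge> 0\<close> show ?thesis
      unfolding R_def by (simp add: add_increasing2)
  qed
  then have "c \<le> R / N"
    using \<open>N > 0\<close> by (simp add: field_simps)
  ultimately show ?thesis
    by (simp add: less_eq_complex_def)
qed

lemma eigenvalue_diag_plus_zero:
  assumes "0 < n"
  shows "eigenvalue (diag_plus_const d 0 n) (of_real (d 0))"
  unfolding eigenvalue_diag_plus_const_iff
  using assms by (intro exI[of _ "\<lambda>i. if i = 0 then 1 else 0"]) auto

lemma eigenvalue_diag_plus_const_repeated:
  assumes "1 < n" "d 0 = d 1"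
  shows "eigenvalue (diag_plus_const d a n) (of_real (d 0))"
proof -
  \<comment> \<open>The entries sum to zero, so the constant part of the matrix annihilates this
    vector.\<close>
  let ?v = "\<lambda>i::nat. if i = 0 then 1 else if i = 1 then - 1 else (0 :: complex)"
  have "(\<Sum>j<n. ?v j) = (\<Sum>j\<in>{0, 1}. ?v j)"
    using assms by (intro sum.mono_neutral_right) auto
  then have "(\<Sum>j<n. ?v j) = 0"
    by simp
  with assms show ?thesis
    unfolding eigenvalue_diag_plus_const_iff
    by (intro exI[of _ ?v]) (auto intro: exI[of _ 0])
qed

text \<open>For \<open>v i = 1 / (d i - l)\<close> the secular equation says that \<open>a\<close>
  times the sum of the entries is \<open>- 1\<close>, so row \<open>i\<close> reduces to
  \<open>(d i - l) * v i = 1\<close>.\<close>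

lemma eigenvalue_diag_plus_const_secular:
  assumes "0 < n" "0 < a" "\<And>i. i < n \<Longrightarrow> d i \<noteq> l" "1 + a * (\<Sum>i<n. 1 / (d i - l)) = 0"
  shows "eigenvalue (diag_plus_const d a n) (of_real l)"
  unfolding eigenvalue_diag_plus_const_iff
proof (intro exI[of _ "\<lambda>i. of_real (1 / (d i - l))"] conjI allI impI)
  show "\<exists>i<n. complex_of_real (1 / (d i - l)) \<noteq> 0"
    using assms(1,3) by (intro exI[of _ 0]) auto
next
  fix i assume "i < n"
  then have "d i * (1 / (d i - l)) = 1 + l * (1 / (d i - l))"
    using assms(3)[of i] by (simp add: field_simps)
  then have "d i * (1 / (d i - l)) + a * (\<Sum>j<n. 1 / (d j - l)) = l * (1 / (d i - l))"
    using assms(4) by linarith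
  then show "of_real (d i) * of_real (1 / (d i - l)) + of_real a * (\<Sum>j<n. of_real (1 / (d j - l)))
      = complex_of_real l * of_real (1 / (d i - l))"
    by (metis of_real_add of_real_mult of_real_sum)
qed

text \<open>
  The intermediate value theorem is applied to \<open>l - d\<^sub>0\<close> times the secular function, which extends
  continuously to \<open>l = d\<^sub>0\<close> with value \<open>-a\<close>.
\<close>

lemma ex_eigenvalue_diag_plus_const_near:
  assumes "0 < n" "0 < a" "0 < e" "\<And>i. 1 \<le> i \<Longrightarrow> i < n \<Longrightarrow> d 0 + e < d i"
    and large: "a < e * (1 + a * (\<Sum>i\<in>{1..<n}. 1 / (d i - d 0)))"
  obtains l where "d 0 \<le> l" "l \<le> d 0 + e" "eigenvalue (diag_plus_const d a n) (of_real l)"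
proof -
  define h where "h l = (l - d 0) * (1 + a * (\<Sum>i\<in>{1..<n}. 1 / (d i - l))) - a" for l
  have "h (d 0) \<le> 0"
    using \<open>0 < a\<close> by (simp add: h_def)
  moreover have "0 \<le> h (d 0 + e)"
  proof -
    \<comment> \<open>Moving the evaluation point right to \<open>d 0 + e\<close> shrinks the
      denominators but keeps them positive, so the hypothesis \<open>large\<close>, stated at
      \<open>d 0\<close>, suffices.\<close>
    have "(\<Sum>i\<in>{1..<n}. 1 / (d i - d 0)) \<le> (\<Sum>i\<in>{1..<n}. 1 / (d i - (d 0 + e)))"
      using assms(3) assms(4) by (intro sum_mono divide_left_mono) (force intro!: mult_pos_pos)+
    then have "e * (1 + a * (\<Sum>i\<in>{1..<n}. 1 / (d i - d 0)))
        \<le> e * (1 + a * (\<Sum>i\<in>{1..<n}. 1 / (d i - (d 0 + e))))"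
      using assms(2,3) by (intro mult_left_mono add_left_mono) auto
    with large show ?thesis
      by (simp add: h_def)
  qed
  moreover have "continuous_on {d 0..d 0 + e} h"
    unfolding h_def using assms(4) by (intro continuous_intros) force
  ultimately obtain l where l: "d 0 \<le> l" "l \<le> d 0 + e" "h l = 0"
    using IVT'[of h "d 0" 0 "d 0 + e"] assms(3) by auto
  have "l \<noteq> d 0"
    using l(3) \<open>0 < a\<close> by (auto simp: h_def)
  have "{..<n} = insert 0 {1..<n}"
    using \<open>0 < n\<close> by auto
  then have "(\<Sum>i<n. 1 / (d i - l)) = 1 / (d 0 - l) + (\<Sum>i\<in>{1..<n}. 1 / (d i - l))"
    by simp
  \<comment> \<open>Here \<open>s\<close> is the singular term of the secular sum and
    \<open>t\<close> the rest; the claim is \<open>h l = 0\<close> divided by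
    \<open>l - d 0\<close>.\<close>
  moreover have "1 + a * (s + t) = 0" if "(l - d 0) * (1 + a * t) = a" "s = 1 / (d 0 - l)" for s t
  proof -
    have "(l - d 0) * s = - 1"
      using that(2) \<open>l \<noteq> d 0\<close> by (simp add: field_simps)
    moreover have "a * s = ((l - d 0) * s) * (1 + a * t)"
      using that(1) by (metis mult.assoc mult.commute)
    ultimately show ?thesis
      by (simp add: distrib_left)
  qed
  ultimately have "1 + a * (\<Sum>i<n. 1 / (d i - l)) = 0"
    using l(3) by (simp add: h_def)
  moreover have "d i \<noteq> l" if "i < n" for i
    using \<open>l \<noteq> d 0\<close> l(2) assms(4)[of i] that by (cases "i = 0") auto
  ultimately show ?thesis
    using that l assms(1,2) eigenvalue_diag_plus_const_secular by blast
qed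

text \<open>The order on the complex numbers is only partial, but the real lower bound forces every
  eigenvalue to be real. The spectrum is then totally ordered and, as the root set of a nonzero
  polynomial, finite, so the \<open>LEAST\<close> is attained.\<close>

lemma smallest_eigenvalue_bounds:
  assumes A: "A \<in> carrier_mat n n"
    and lower: "\<And>l. eigenvalue A l \<Longrightarrow> complex_of_real c \<le> l"
    and k: "eigenvalue A k"
  shows "complex_of_real c \<le> smallest_eigenvalue A" "smallest_eigenvalue A \<le> k"
proof -
  have "n > 0"
    using A k by (auto simp: eigenvalue_def eigenvector_def)
  let ?E = "{l. eigenvalue A l}"
  have "char_poly A \<noteq> 0"
    using degree_monic_char_poly[OF A] \<open>n > 0\<close> by auto
  then have fin: "finite ?E"
    using poly_roots_finite by (simp add: eigenvalue_root_char_poly[OF A])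
  have total: "l \<le> m \<longleftrightarrow> Re l \<le> Re m" if "l \<in> ?E" "m \<in> ?E" for l m
    using lower[of l] lower[of m] that by (auto simp: less_eq_complex_def)
  obtain m where m: "m \<in> ?E" "\<And>l. l \<in> ?E \<Longrightarrow> Re m \<le> Re l"
    using ex_is_arg_min_if_finite[OF fin, of Re] k by (auto simp: is_arg_min_linorder)
  have "smallest_eigenvalue A = m"
    unfolding smallest_eigenvalue_def using m total by (intro Least_equality) auto
  with m total k lower show "complex_of_real c \<le> smallest_eigenvalue A" "smallest_eigenvalue A \<le> k"
    by auto
qed

section \<open>The limit\<close>

lemma gcd_matrix_eq_diag_plus_const:
  assumes "\<And>i j. i \<ge> 1 \<Longrightarrow> j \<ge> 1 \<Longrightarrow> i \<noteq> j \<Longrightarrow> gcd (xs i) (xs j) = x"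
    and "f x = of_real a" "\<And>i. i \<ge> 1 \<Longrightarrow> f (xs i) = of_real (F i)"
  shows "gcd_matrix f xs n = diag_plus_const (\<lambda>i. F (Suc i) - a) a n"
  unfolding gcd_matrix_def diag_plus_const_def
  using assms by (intro cong_mat) auto

text \<open>Every eigenvalue is at least \<open>d 0\<close>, so it suffices to find, for large
  \<open>n\<close>, one eigenvalue close to \<open>d 0\<close>. The weights \<open>w i\<close> stand
  for \<open>C\<close> times the sequence.\<close>

lemma smallest_eigenvalue_diag_plus_const_tendsto:
  fixes d w :: "nat \<Rightarrow> real"
  assumes "0 \<le> a" "mono d"
    and w: "\<And>i. 1 \<le> i \<Longrightarrow> d i - d 0 \<le> w i" "\<And>i. 0 < w i"
    and div: "filterlim (\<lambda>n. \<Sum>i\<in>{1..<n}. 1 / w i) at_top sequentially"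
  shows "(\<lambda>n. smallest_eigenvalue (diag_plus_const d a n)) \<longlonglongrightarrow> of_real (d 0)"
proof -
  have near: "\<forall>\<^sub>F n in sequentially. \<exists>l. d 0 \<le> l \<and> l \<le> d 0 + e \<and>
      eigenvalue (diag_plus_const d a n) (of_real l)" if "e > 0" for e
  proof (cases "a = 0 \<or> d 0 = d 1")
    case True
    have "eigenvalue (diag_plus_const d a n) (of_real (d 0))" if "n > 1" for n
      using True that eigenvalue_diag_plus_zero[of n d] eigenvalue_diag_plus_const_repeated[of n d a]
      by auto
    with \<open>e > 0\<close> show ?thesis
      by (intro eventually_mono[OF eventually_gt_at_top[of 1]] exI[of _ "d 0"]) auto
  next
    case False
    then have "a > 0" "d 0 < d 1"
      using \<open>0 \<le> a\<close> monoD[OF \<open>mono d\<close>, of 0 1] by auto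
    \<comment> \<open>Capping at half the first gap keeps all \<open>d i\<close> with
      \<open>i \<ge> 1\<close> to the right of \<open>d 0 + e'\<close>.\<close>
    define e' where "e' = min e ((d 1 - d 0) / 2)"
    have e': "0 < e'" "e' \<le> e" "d 0 + e' < d 1"
      using \<open>e > 0\<close> \<open>d 0 < d 1\<close> by (auto simp: e'_def min_def field_simps)
    have gap: "d 0 + e' < d i" if "1 \<le> i" for i
      using e'(3) monoD[OF \<open>mono d\<close> that] by linarith
    \<comment> \<open>Beyond this threshold \<open>e'\<close> times the sum exceeds 1, so
      \<open>a * e'\<close> times the sum exceeds \<open>a\<close>.\<close>
    have "\<forall>\<^sub>F n in sequentially. 1 / e' < (\<Sum>i\<in>{1..<n}. 1 / w i)"
      using div by (simp add: filterlim_at_top_dense)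
    with eventually_gt_at_top[of 0] show ?thesis
    proof eventually_elim
      case (elim n)
      have "(\<Sum>i\<in>{1..<n}. 1 / w i) \<le> (\<Sum>i\<in>{1..<n}. 1 / (d i - d 0))"
        using gap w e' by (intro sum_mono divide_left_mono) (force intro!: mult_pos_pos)+
      with elim have "1 / e' < (\<Sum>i\<in>{1..<n}. 1 / (d i - d 0))"
        by linarith
      then have "1 < e' * (\<Sum>i\<in>{1..<n}. 1 / (d i - d 0))"
        using e' by (simp add: field_simps)
      then have "a * 1 < a * (e' * (\<Sum>i\<in>{1..<n}. 1 / (d i - d 0)))"
        using \<open>a > 0\<close> by (intro mult_strict_left_mono)
      then have "a < e' * (1 + a * (\<Sum>i\<in>{1..<n}. 1 / (d i - d 0)))"
        using e' by (simp add: algebra_simps)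
      then obtain l where "d 0 \<le> l" "l \<le> d 0 + e'"
          "eigenvalue (diag_plus_const d a n) (of_real l)"
        using ex_eigenvalue_diag_plus_const_near[of n a e' d] \<open>a > 0\<close> e' gap elim by auto
      with e' show ?case by force
    qed
  qed
  have ge: "complex_of_real (d 0) \<le> l" if "eigenvalue (diag_plus_const d a n) l" for n l
    using that \<open>0 \<le> a\<close> monoD[OF \<open>mono d\<close>] by (intro eigenvalue_diag_plus_const_ge) auto
  show ?thesis
  proof (rule tendstoI)
    fix e :: real assume "e > 0"
    \<comment> \<open>\<open>near\<close> gives a non-strict bound, whereas convergence asks for a
      strict one.\<close>
    then have "e / 2 > 0" by simp
    from near[OF this]
    show "\<forall>\<^sub>F n in sequentially. dist (smallest_eigenvalue (diag_plus_const d a n)) (of_real (d 0)) < e"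
    proof eventually_elim
      case (elim n)
      then obtain l where l: "l \<le> d 0 + e / 2" "eigenvalue (diag_plus_const d a n) (of_real l)"
        by blast
      note b = smallest_eigenvalue_bounds[OF diag_plus_const_carrier ge[of n] l(2)]
      define s where "s = smallest_eigenvalue (diag_plus_const d a n)"
      have s: "Im s = 0" "d 0 \<le> Re s" "Re s \<le> d 0 + e / 2"
        using b l(1) unfolding s_def by (auto simp: less_eq_complex_def)
      then have "s - of_real (d 0) = of_real (Re s - d 0)"
        by (simp add: complex_eq_iff)
      then have "dist s (of_real (d 0)) = \<bar>Re s - d 0\<bar>"
        by (simp only: dist_norm norm_of_real)
      with s \<open>e > 0\<close> show ?case
        unfolding s_def by auto
    qed
  qed
qed

theorem theorem1p5:
  fixes x :: nat and xs :: "nat \<Rightarrow> nat" and f :: "nat \<Rightarrow> complex" and C :: real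
  assumes "x > 0"
    and "\<And>i. i \<ge> 1 \<Longrightarrow> xs i > 0"
    and "strict_mono_on {1..} xs"
    and "\<And>i j. i \<ge> 1 \<Longrightarrow> j \<ge> 1 \<Longrightarrow> i \<noteq> j \<Longrightarrow> gcd (xs i) (xs j) = x"
    and "filterlim (\<lambda>n. \<Sum>i=1..n. 1 / real (xs i)) at_top sequentially"
    and "f \<in> class_C xs"
    and "\<And>i j. 1 \<le> i \<Longrightarrow> i < j \<Longrightarrow> f (xs i) \<le> f (xs j)"
    and "C > 0"
    and "\<And>i. i \<ge> 1 \<Longrightarrow> f (xs i) \<le> complex_of_real C * of_nat (xs i)"
  shows "(\<lambda>n. smallest_eigenvalue (gcd_matrix f xs n)) \<longlonglongrightarrow> f (xs 1) - f x"
proof -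
  define a where "a = Re (f x)"
  define F where "F i = Re (f (xs i))" for i
  define d where "d i = F (Suc i) - a" for i
  define w where "w i = C * real (xs (Suc i))" for i
  \<comment> \<open>The class constrains \<open>f\<close> only at divisors of the sequence; this
    brings \<open>x\<close> among them.\<close>
  have "x dvd xs 1"
    using assms(4)[of 1 2] gcd_dvd1[of "xs 1" "xs 2"] by simp
  then have fx: "0 \<le> f x"
    using assms(1) class_C_nonneg[OF assms(6), of 1 x] by simp
  have fxs: "0 \<le> f (xs i)" if "i \<ge> 1" for i
    using that assms(2) by (intro class_C_nonneg[OF assms(6) that]) auto
  have a: "f x = of_real a" "0 \<le> a"
    using fx by (auto simp: a_def less_eq_complex_def complex_eq_iff)
  have F: "f (xs i) = of_real (F i)" "0 \<le> F i" if "i \<ge> 1" for i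
    using fxs[OF that] by (auto simp: F_def less_eq_complex_def complex_eq_iff)
  have "mono d"
    unfolding mono_iff_le_Suc d_def F_def
    using assms(7) by (auto simp: less_eq_complex_def)
  \<comment> \<open>In the difference \<open>a\<close> cancels, and dropping
    \<open>F 1 \<ge> 0\<close> leaves the growth bound on \<open>f\<close>.\<close>
  moreover have "d i - d 0 \<le> w i" for i
    using assms(9)[of "Suc i"] F(2)[of 1] by (simp add: d_def w_def F_def less_eq_complex_def)
  moreover have "0 < w i" for i
    using assms(2,8) by (simp add: w_def)
  moreover have "filterlim (\<lambda>n. \<Sum>i\<in>{1..<n}. 1 / w i) at_top sequentially"
  proof -
    \<comment> \<open>Because of the index shift the left side is the given partial sum without the
      term of \<open>xs 1\<close>, scaled by \<open>1 / C\<close>; neither change affects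
      divergence. At \<open>n = 0\<close> there is no such term to remove.\<close>
    have "(\<Sum>i\<in>{1..<n}. 1 / w i) = - 1 / (C * real (xs 1)) + 1 / C * (\<Sum>i=1..n. 1 / real (xs i))"
      if "n > 0" for n
    proof -
      have "(\<Sum>i=1..n. 1 / real (xs i)) = (\<Sum>i\<in>{0..<n}. 1 / real (xs (Suc i)))"
        by (simp add: sum.atLeast_Suc_atMost_Suc_shift sum.atLeast1_atMost_eq lessThan_atLeast0)
      also have "\<dots> = 1 / real (xs 1) + (\<Sum>i\<in>{1..<n}. 1 / real (xs (Suc i)))"
        using that by (simp add: sum.atLeast_Suc_lessThan)
      finally show ?thesis
        by (simp add: w_def sum_distrib_left distrib_left)
    qed
    moreover have "filterlim (\<lambda>n. - 1 / (C * real (xs 1)) + 1 / C * (\<Sum>i=1..n. 1 / real (xs i)))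
        at_top sequentially"
      using assms(5,8)
      by (intro filterlim_tendsto_add_at_top[OF tendsto_const]
            filterlim_tendsto_pos_mult_at_top[OF tendsto_const]) auto
    ultimately show ?thesis
      by (subst filterlim_cong[OF refl refl]) (auto intro: eventually_mono[OF eventually_gt_at_top[of 0]])
  qed
  ultimately have "(\<lambda>n. smallest_eigenvalue (diag_plus_const d a n)) \<longlonglongrightarrow> of_real (d 0)"
    using a(2) by (intro smallest_eigenvalue_diag_plus_const_tendsto) auto
  moreover have "gcd_matrix f xs n = diag_plus_const d a n" for n
    unfolding d_def using assms(4) a(1) F(1) by (rule gcd_matrix_eq_diag_plus_const)
  ultimately show ?thesis
    using a(1) F(1)[of 1] by (simp add: d_def)
qed

end
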